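(* Let $X$ be a fuzzy weakly-compact fuzzy topological space. Then $\bigwedge_{A\in\Gamma}cl(A)\neq0_X$ for every fuzzy filterbase $\Gamma$ in $X$ consisting of fuzzy weakly-closed sets.
   Context: Fuzzy topological spaces (FTS) are in Chang's sense: a fuzzy set in $X$ is a function $X\to[0,1]$, ordered pointwise by $\leq$, with $\vee,\wedge$ pointwise supremum and infimum and complement $A^c=1-A$; $0_X,1_X$ are the constant functions. A fuzzy topology $\tau$ on $X$ is a family of fuzzy sets containing $0_X,1_X$ and closed under finite $\wedge$ and arbitrary $\bigvee$; members of $\tau$ are fuzzy open and their complements fuzzy closed. $cl(A)$ is the infimum of all fuzzy closed sets $\geq A$ and $int(A)$ is the supremum of all fuzzy open sets $\leq A$. A fuzzy set $A$ is fuzzy semi-closed if $int(cl(A))\leq A$; a fuzzy set is fuzzy semi-open if its complement is fuzzy semi-closed. A fuzzy set $A$ is fuzzy weakly-closed if $cl(A)\leq U$ for every fuzzy semi-open set $U$ with $A\leq U$. A fuzzy set is fuzzy weakly-open if its complement is fuzzy weakly-closed. A collection $\Gamma$ of fuzzy sets in $X$ is a fuzzy filterbase if $\bigwedge_{j=1}^nA_j\neq0_X$ for every finite subcollection $\{A_1,\dots,A_n\}$ of $\Gamma$. $X$ is fuzzy weakly-compact if every family $\{G_\lambda\mid\lambda\in\Lambda\}$ of fuzzy weakly-open sets with $\bigvee_{\lambda\in\Lambda}G_\lambda=1_X$ has a finite subfamily $G_{\lambda_1},\dots,G_{\lambda_n}$ with $\bigvee_{i=1}^nG_{\lambda_i}=1_X$.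 *)

theory Defs
  imports Complex_Main
begin

section \<open>The complete lattice of membership grades\<close>

text \<open>
  The closed real unit interval is made a type of its own so that suprema and infima of arbitrary
  families exist in it; in particular the empty family has supremum 0 and infimum 1, which fails for
  \<^const>\<open>Sup\<close> and \<^const>\<open>Inf\<close> on \<^typ>\<open>real\<close>.
\<close>

typedef grade = "{0..1::real}"
  morphisms real_of_grade Grade
  by (rule exI[of _ 0]) simp

setup_lifting type_definition_grade

instantiation grade :: complete_linorder
begin

lift_definition less_eq_grade :: "grade \<Rightarrow> grade \<Rightarrow> bool" is "(\<le>)" .

lift_definition less_grade :: "grade \<Rightarrow> grade \<Rightarrow> bool" is "(<)" .

lift_definition bot_grade :: grade is 0 by simp

lift_definition top_grade :: grade is 1 by simp

lift_definition inf_grade :: "grade \<Rightarrow> grade \<Rightarrow> grade" is min by (simp add: min_def)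

lift_definition sup_grade :: "grade \<Rightarrow> grade \<Rightarrow> grade" is max by (simp add: max_def)

definition Sup_grade :: "grade set \<Rightarrow> grade" where
  "Sup S = (if S = {} then bot else Grade (Sup (real_of_grade ` S)))"

definition Inf_grade :: "grade set \<Rightarrow> grade" where
  "Inf S = (if S = {} then top else Grade (Inf (real_of_grade ` S)))"

instance
proof
  have bounds: "0 \<le> real_of_grade a" "real_of_grade a \<le> 1" for a
    using real_of_grade[of a] by auto
  have bdd: "bdd_above (real_of_grade ` S)" "bdd_below (real_of_grade ` S)" for S
    using bounds by (auto intro!: bdd_aboveI[of _ 1] bdd_belowI[of _ 0])
  have Sup_rep: "real_of_grade (Sup S) = Sup (real_of_grade ` S)" if ne: "S \<noteq> {}" for S
  proof -
    obtain a where a: "a \<in> S" using ne by blast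
    have "0 \<le> Sup (real_of_grade ` S)"
      by (rule order_trans[OF bounds(1)[of a]]) (use a bdd in \<open>auto intro: cSup_upper\<close>)
    moreover have "Sup (real_of_grade ` S) \<le> 1"
      by (rule cSup_least) (use that bounds in auto)
    ultimately show ?thesis using that by (simp add: Sup_grade_def Grade_inverse)
  qed
  have Inf_rep: "real_of_grade (Inf S) = Inf (real_of_grade ` S)" if ne: "S \<noteq> {}" for S
  proof -
    obtain a where a: "a \<in> S" using ne by blast
    have "Inf (real_of_grade ` S) \<le> 1"
      by (rule order_trans[OF _ bounds(2)[of a]]) (use a bdd in \<open>auto intro: cInf_lower\<close>)
    moreover have "0 \<le> Inf (real_of_grade ` S)"
      by (rule cInf_greatest) (use that bounds in auto)
    ultimately show ?thesis using that by (simp add: Inf_grade_def Grade_inverse)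
  qed
  fix x y z :: grade and S :: "grade set"
  show "x < y \<longleftrightarrow> x \<le> y \<and> \<not> y \<le> x" by transfer auto
  show "x \<le> x" by transfer simp
  show "x \<le> y \<Longrightarrow> y \<le> z \<Longrightarrow> x \<le> z" by transfer simp
  show "x \<le> y \<Longrightarrow> y \<le> x \<Longrightarrow> x = y" by transfer simp
  show "x \<le> y \<or> y \<le> x" by transfer auto
  show "inf x y \<le> x" by transfer simp
  show "inf x y \<le> y" by transfer simp
  show "x \<le> y \<Longrightarrow> x \<le> z \<Longrightarrow> x \<le> inf y z" by transfer simp
  show "x \<le> sup x y" by transfer simp
  show "y \<le> sup x y" by transfer simp
  show "y \<le> x \<Longrightarrow> z \<le> x \<Longrightarrow> sup y z \<le> x" by transfer simp
  show "x \<le> Sup S" if "x \<in> S"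
  proof -
    have "S \<noteq> {}" using that by auto
    then show ?thesis
      using that bdd by (auto simp: less_eq_grade.rep_eq Sup_rep intro: cSup_upper)
  qed
  show "Inf S \<le> x" if "x \<in> S"
  proof -
    have "S \<noteq> {}" using that by auto
    then show ?thesis
      using that bdd by (auto simp: less_eq_grade.rep_eq Inf_rep intro: cInf_lower)
  qed
  show "Sup S \<le> z" if "\<And>x. x \<in> S \<Longrightarrow> x \<le> z"
  proof (cases "S = {}")
    case True
    then show ?thesis using bounds by (simp add: Sup_grade_def less_eq_grade.rep_eq bot_grade.rep_eq)
  next
    case False
    then show ?thesis
      using that by (auto simp: less_eq_grade.rep_eq Sup_rep intro!: cSup_least)
  qed
  show "z \<le> Inf S" if "\<And>x. x \<in> S \<Longrightarrow> z \<le> x"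
  proof (cases "S = {}")
    case True
    then show ?thesis using bounds by (simp add: Inf_grade_def less_eq_grade.rep_eq top_grade.rep_eq)
  next
    case False
    then show ?thesis
      using that by (auto simp: less_eq_grade.rep_eq Inf_rep intro!: cInf_greatest)
  qed
  show "Inf {} = (top :: grade)" by (simp add: Inf_grade_def)
  show "Sup {} = (bot :: grade)" by (simp add: Sup_grade_def)
qed

end

lift_definition compl_grade :: "grade \<Rightarrow> grade" is "\<lambda>t. 1 - t" by simp


section \<open>Fuzzy sets and fuzzy topological spaces\<close>

text \<open>
  The underlying set of the space is the (nonempty) type \<open>'a\<close>. The pointwise order, suprema and
  infima of fuzzy sets are those of the function type; \<^const>\<open>bot\<close> and \<^const>\<open>top\<close> are the
  constant functions 0 and 1.
\<close>

type_synonym 'a fuzzy_set = "'a \<Rightarrow> grade"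

definition fuzzy_compl :: "'a fuzzy_set \<Rightarrow> 'a fuzzy_set" where
  "fuzzy_compl A = (\<lambda>x. compl_grade (A x))"

definition fuzzy_topology :: "'a fuzzy_set set \<Rightarrow> bool" where
  "fuzzy_topology \<tau> \<longleftrightarrow>
     bot \<in> \<tau> \<and> top \<in> \<tau> \<and>
     (\<forall>A\<in>\<tau>. \<forall>B\<in>\<tau>. inf A B \<in> \<tau>) \<and>
     (\<forall>\<G>. \<G> \<subseteq> \<tau> \<longrightarrow> Sup \<G> \<in> \<tau>)"

definition fuzzy_open :: "'a fuzzy_set set \<Rightarrow> 'a fuzzy_set \<Rightarrow> bool" where
  "fuzzy_open \<tau> A \<longleftrightarrow> A \<in> \<tau>"

definition fuzzy_closed :: "'a fuzzy_set set \<Rightarrow> 'a fuzzy_set \<Rightarrow> bool" where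
  "fuzzy_closed \<tau> A \<longleftrightarrow> fuzzy_open \<tau> (fuzzy_compl A)"

definition fuzzy_cl :: "'a fuzzy_set set \<Rightarrow> 'a fuzzy_set \<Rightarrow> 'a fuzzy_set" where
  "fuzzy_cl \<tau> A = Inf {F. fuzzy_closed \<tau> F \<and> A \<le> F}"

definition fuzzy_int :: "'a fuzzy_set set \<Rightarrow> 'a fuzzy_set \<Rightarrow> 'a fuzzy_set" where
  "fuzzy_int \<tau> A = Sup {U. fuzzy_open \<tau> U \<and> U \<le> A}"

definition fuzzy_semi_closed :: "'a fuzzy_set set \<Rightarrow> 'a fuzzy_set \<Rightarrow> bool" where
  "fuzzy_semi_closed \<tau> A \<longleftrightarrow> fuzzy_int \<tau> (fuzzy_cl \<tau> A) \<le> A"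

definition fuzzy_semi_open :: "'a fuzzy_set set \<Rightarrow> 'a fuzzy_set \<Rightarrow> bool" where
  "fuzzy_semi_open \<tau> A \<longleftrightarrow> fuzzy_semi_closed \<tau> (fuzzy_compl A)"

definition fuzzy_weakly_closed :: "'a fuzzy_set set \<Rightarrow> 'a fuzzy_set \<Rightarrow> bool" where
  "fuzzy_weakly_closed \<tau> A \<longleftrightarrow> (\<forall>U. fuzzy_semi_open \<tau> U \<and> A \<le> U \<longrightarrow> fuzzy_cl \<tau> A \<le> U)"

definition fuzzy_weakly_open :: "'a fuzzy_set set \<Rightarrow> 'a fuzzy_set \<Rightarrow> bool" where
  "fuzzy_weakly_open \<tau> A \<longleftrightarrow> fuzzy_weakly_closed \<tau> (fuzzy_compl A)"

text \<open>
  The empty subcollection is admitted in the next two definitions. This is harmless: its infimum is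
  the constant function 1 and its supremum the constant function 0, and these differ.
\<close>

definition fuzzy_filterbase :: "'a fuzzy_set set \<Rightarrow> bool" where
  "fuzzy_filterbase \<Gamma> \<longleftrightarrow> (\<forall>\<F>. finite \<F> \<and> \<F> \<subseteq> \<Gamma> \<longrightarrow> Inf \<F> \<noteq> bot)"

definition fuzzy_weakly_compact :: "'a fuzzy_set set \<Rightarrow> bool" where
  "fuzzy_weakly_compact \<tau> \<longleftrightarrow>
     (\<forall>\<G>. (\<forall>G\<in>\<G>. fuzzy_weakly_open \<tau> G) \<and> Sup \<G> = top \<longrightarrow>
        (\<exists>\<F>. finite \<F> \<and> \<F> \<subseteq> \<G> \<and> Sup \<F> = top))"

end

theory Submission
  imports Defs
begin

text \<open>Compactness is used in its dual, finite-intersection form. If \<Gamma> had infimum 0,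
  the complements of its members would form a weakly open cover by De Morgan
  (\<open>fuzzy_compl_Inf\<close>). A finite subcover, complemented back, would be a finite part of
  \<Gamma> with infimum 0, against the filterbase condition. So \<open>Inf \<Gamma>\<close> itself
  is nonzero (\<open>weakly_compact_Inf_neq_bot\<close>), and closures only enlarge the members
  (\<open>le_fuzzy_cl\<close>).\<close>

lemma compl_grade_involutive [simp]: "compl_grade (compl_grade a) = a"
  by transfer simp

lemma compl_grade_mono_iff [simp]: "compl_grade a \<le> compl_grade b \<longleftrightarrow> b \<le> a"
  by transfer auto

lemma fuzzy_compl_involutive [simp]: "fuzzy_compl (fuzzy_compl A) = A"
  by (simp add: fuzzy_compl_def)

lemma fuzzy_compl_mono_iff [simp]: "fuzzy_compl A \<le> fuzzy_compl B \<longleftrightarrow> B \<le> A"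
  by (simp add: fuzzy_compl_def le_fun_def)

text \<open>De Morgan holds because complementation is an order-reversing involution: the harder
  inequality is moved across it and becomes a statement about lower bounds of \<S>.\<close>

lemma fuzzy_compl_Inf: "fuzzy_compl (Inf \<S>) = Sup (fuzzy_compl ` \<S>)"
proof (rule antisym)
  have "fuzzy_compl (Sup (fuzzy_compl ` \<S>)) \<le> A" if "A \<in> \<S>" for A
    using that fuzzy_compl_mono_iff[of "Sup (fuzzy_compl ` \<S>)" "fuzzy_compl A"]
    by (simp add: Sup_upper)
  then have "fuzzy_compl (Sup (fuzzy_compl ` \<S>)) \<le> Inf \<S>"
    by (rule Inf_greatest)
  then show "fuzzy_compl (Inf \<S>) \<le> Sup (fuzzy_compl ` \<S>)"
    by (metis fuzzy_compl_involutive fuzzy_compl_mono_iff)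
  show "Sup (fuzzy_compl ` \<S>) \<le> fuzzy_compl (Inf \<S>)"
    by (auto intro!: SUP_least Inf_lower)
qed

lemma fuzzy_compl_bot [simp]: "fuzzy_compl bot = top"
  \<comment> \<open>Complementing \<open>bot \<le> fuzzy_compl top\<close> reverses it to
    \<open>top \<le> fuzzy_compl bot\<close>.\<close>
  using bot_least[of "fuzzy_compl top"] fuzzy_compl_mono_iff[of "fuzzy_compl top" bot]
  by (simp add: top_unique)

lemma fuzzy_compl_eq_top_iff: "fuzzy_compl A = top \<longleftrightarrow> A = bot"
  by (metis fuzzy_compl_bot fuzzy_compl_involutive)

lemma le_fuzzy_cl: "A \<le> fuzzy_cl \<tau> A"
  by (auto simp: fuzzy_cl_def intro: Inf_greatest)

lemma weakly_compact_Inf_neq_bot: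
  assumes "fuzzy_weakly_compact \<tau>" and "fuzzy_filterbase \<Gamma>"
    and closed: "\<And>A. A \<in> \<Gamma> \<Longrightarrow> fuzzy_weakly_closed \<tau> A"
  shows "Inf \<Gamma> \<noteq> bot"
proof
  assume "Inf \<Gamma> = bot"
  then have "Sup (fuzzy_compl ` \<Gamma>) = top"
    by (simp flip: fuzzy_compl_Inf)
  moreover have "\<forall>G\<in>fuzzy_compl ` \<Gamma>. fuzzy_weakly_open \<tau> G"
    using closed by (simp add: fuzzy_weakly_open_def)
  ultimately obtain \<F> where "finite \<F>" "\<F> \<subseteq> fuzzy_compl ` \<Gamma>" "Sup \<F> = top"
    using assms(1) unfolding fuzzy_weakly_compact_def by meson
  \<comment> \<open>A finite subset of an image is the image of a finite subset, so the subcover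
    comes from a finite \<C> to which the filterbase condition applies.\<close>
  then obtain \<C> where "finite \<C>" "\<C> \<subseteq> \<Gamma>" "Sup (fuzzy_compl ` \<C>) = top"
    by (metis finite_subset_image)
  then show False
    using assms(2) by (simp add: fuzzy_filterbase_def fuzzy_compl_eq_top_iff flip: fuzzy_compl_Inf)
qed

theorem theorem4p7:
  fixes \<tau> :: "'a fuzzy_set set"
  assumes "fuzzy_topology \<tau>"
    and "fuzzy_weakly_compact \<tau>"
  shows "\<forall>\<Gamma>. fuzzy_filterbase \<Gamma> \<and> (\<forall>A\<in>\<Gamma>. fuzzy_weakly_closed \<tau> A) \<longrightarrow>
           (INF A\<in>\<Gamma>. fuzzy_cl \<tau> A) \<noteq> bot"
proof (intro allI impI)
  fix \<Gamma>
  assume "fuzzy_filterbase \<Gamma> \<and> (\<forall>A\<in>\<Gamma>. fuzzy_weakly_closed \<tau> A)"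
  then have "Inf \<Gamma> \<noteq> bot"
    using weakly_compact_Inf_neq_bot[OF assms(2)] by blast
  moreover have "Inf \<Gamma> \<le> (INF A\<in>\<Gamma>. fuzzy_cl \<tau> A)"
    by (rule INF_greatest) (rule order_trans[OF Inf_lower le_fuzzy_cl])
  ultimately show "(INF A\<in>\<Gamma>. fuzzy_cl \<tau> A) \<noteq> bot"
    by (metis bot_unique)
qed

end
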